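(* Let $\hat\mu:=C^\top\rho_0+\overline C^\top\hat\eta$ and consider the problem (Q) $$\min_{M_0,\dots,M_{T-1}\ge0}\ \mathcal D\big(M_0\,|\,\operatorname{diag}(\hat\mu)A_0\big)+\sum_{t=1}^{T-1}\mathcal D\big(M_t\,|\,\operatorname{diag}(M_t\mathbf 1)A_t\big)$$ subject to $CM_t\mathbf 1=\rho_t$ for $t=0,\dots,T-1$, $CM_{T-1}^\top\mathbf 1=\rho_T$, and $M_t\mathbf 1=M_{t-1}^\top\mathbf 1$ for $t=1,\dots,T-1$. The (Lagrangian) dual of (Q) is $$\max_{\lambda_0,\dots,\lambda_T}\ \sum_{t=0}^T\lambda_t^\top\rho_t-\hat\mu^\top\operatorname{diag}(u_0)A_0\operatorname{diag}(u_1)A_1\cdots\operatorname{diag}(u_{T-1})A_{T-1}u_T,$$ where $\lambda_t\in\mathbb{R}^k$ and $u_t:=\exp(C^\top\lambda_t)$ for $t=0,\dots,T$.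
   Context: Setting. Let $n,T\ge1$ be integers and let $A_0,\dots,A_{T-1}\in\mathbb{R}^{n\times n}_{\ge0}$ be row-stochastic matrices ($A_t\mathbf 1=\mathbf 1$). Let $\pi=\{\pi_1,\dots,\pi_k\}\subseteq\{1,\dots,n\}$ have $k$ elements, let $C=[e_{\pi_1},\dots,e_{\pi_k}]^\top\in\{0,1\}^{k\times n}$ be the coordinate-selection matrix of $\pi$, and let $\overline C\in\{0,1\}^{(n-k)\times n}$ be the coordinate-selection matrix of $\{1,\dots,n\}\setminus\pi$. Let $\rho_0,\dots,\rho_T\in\mathbb{R}^k$ (nonnegative observed masses) and $\hat\eta\in\mathbb{R}^{n-k}_{\ge0}$ be given. Notation. $\mathbf 1$ is the all-ones vector; $\exp$ is entrywise; $\operatorname{supp}$ is the set of positions of nonzero entries. For nonnegative arrays $p,q$ of the same size with $\operatorname{supp}(p)\subseteq\operatorname{supp}(q)$, $\mathcal D(p\,|\,q)=\sum_i\big(p_i\log(p_i/q_i)-p_i+q_i\big)$, with $0\log 0:=0$ (terms with $p_i=q_i=0$ are $0$). In (Q) the matrices are $M_t\in\mathbb{R}^{n\times n}_{\ge0}$ whose supports are such that the divergences are defined, i.e. $\operatorname{supp}(M_0)\subseteq\operatorname{supp}(\operatorname{diag}(\hat\mu)A_0)$ and $\operatorname{supp}(M_t)\subseteq\operatorname{supp}(A_t)$ for $t\ge1$.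
   Formalization: The dual objective is corrected by adding the constant $\mathbf 1^\top\hat\mu$, which the displayed formula omits: with $n=k=T=1$, $A_0=1$, $\rho_0=\rho_1=1$ the Lagrangian dual has value $0$ but the displayed maximum is $-1$; the maximising $\lambda$ are unaffected. *)

theory Defs
  imports Complex_Main "HOL-Library.Extended_Real" "Jordan_Normal_Form.Matrix"
begin

section \<open>Lagrangian duality for equality-constrained minimisation\<close>

text \<open>
  A program minimises \<open>ep_obj\<close> over the \<open>x\<close> in \<open>ep_dom\<close> for which the residual vectors
  \<open>ep_res x i\<close>, of dimension \<open>ep_dim i\<close>, vanish for all \<open>i\<close> in the finite set \<open>ep_idx\<close>.
  Membership in \<open>ep_dom\<close> is not dualised; every residual is.
\<close>

record ('x, 'i) eq_program =
  ep_dom :: "'x set"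
  ep_obj :: "'x \<Rightarrow> real"
  ep_idx :: "'i set"
  ep_dim :: "'i \<Rightarrow> nat"
  ep_res :: "'x \<Rightarrow> 'i \<Rightarrow> real vec"

definition ep_feasible :: "('x, 'i) eq_program \<Rightarrow> 'x set" where
  "ep_feasible P = {x \<in> ep_dom P. \<forall>i\<in>ep_idx P. ep_res P x i = 0\<^sub>v (ep_dim P i)}"

definition multipliers :: "('x, 'i) eq_program \<Rightarrow> ('i \<Rightarrow> real vec) set" where
  "multipliers P = {y. \<forall>i\<in>ep_idx P. y i \<in> carrier_vec (ep_dim P i)}"

definition lagrangian :: "('x, 'i) eq_program \<Rightarrow> 'x \<Rightarrow> ('i \<Rightarrow> real vec) \<Rightarrow> real" where
  "lagrangian P x y = ep_obj P x + (\<Sum>i\<in>ep_idx P. y i \<bullet> ep_res P x i)"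

definition dual_fun :: "('x, 'i) eq_program \<Rightarrow> ('i \<Rightarrow> real vec) \<Rightarrow> ereal" where
  "dual_fun P y = (INF x\<in>ep_dom P. ereal (lagrangian P x y))"

definition dual_value :: "('x, 'i) eq_program \<Rightarrow> ereal" where
  "dual_value P = (SUP y\<in>multipliers P. dual_fun P y)"

definition dual_optimal :: "('x, 'i) eq_program \<Rightarrow> ('i \<Rightarrow> real vec) \<Rightarrow> bool" where
  "dual_optimal P y \<longleftrightarrow> y \<in> multipliers P \<and> (\<forall>y'\<in>multipliers P. dual_fun P y' \<le> dual_fun P y)"


section \<open>Vectors and matrices\<close>

definition ones :: "nat \<Rightarrow> real vec" where
  "ones n = vec n (\<lambda>_. 1)"

definition diag_of :: "real vec \<Rightarrow> real mat" where
  "diag_of v = mat_diag (dim_vec v) (\<lambda>i. v $ i)"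

definition nonneg_vec :: "real vec \<Rightarrow> bool" where
  "nonneg_vec v \<longleftrightarrow> (\<forall>i<dim_vec v. 0 \<le> v $ i)"

definition nonneg_mat :: "real mat \<Rightarrow> bool" where
  "nonneg_mat M \<longleftrightarrow> (\<forall>i<dim_row M. \<forall>j<dim_col M. 0 \<le> M $$ (i, j))"

definition supp_mat :: "real mat \<Rightarrow> (nat \<times> nat) set" where
  "supp_mat M = {(i, j). i < dim_row M \<and> j < dim_col M \<and> M $$ (i, j) \<noteq> 0}"

definition row_stochastic :: "nat \<Rightarrow> real mat \<Rightarrow> bool" where
  "row_stochastic n A \<longleftrightarrow> A \<in> carrier_mat n n \<and> nonneg_mat A \<and> A *\<^sub>v ones n = ones n"

text \<open>Coordinates are \<open>0, \<dots>, n - 1\<close>; row \<open>i\<close> of \<open>coord_sel n ps\<close> is the unit vector at \<open>ps ! i\<close>.\<close>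

definition coord_sel :: "nat \<Rightarrow> nat list \<Rightarrow> real mat" where
  "coord_sel n ps = mat (length ps) n (\<lambda>(i, j). if j = ps ! i then 1 else 0)"

text \<open>
  Meaningful for nonnegative matrices of equal size with \<open>supp_mat P \<subseteq> supp_mat Q\<close>. The convention
  \<open>0 log 0 = 0\<close> needs no case distinction, since the logarithm is multiplied by \<open>0\<close>.
\<close>

definition kl_div :: "real mat \<Rightarrow> real mat \<Rightarrow> real" where
  "kl_div P Q = (\<Sum>i<dim_row P. \<Sum>j<dim_col P.
     P $$ (i, j) * ln (P $$ (i, j) / Q $$ (i, j)) - P $$ (i, j) + Q $$ (i, j))"


section \<open>The primal problem\<close>

text \<open>
  \<open>Obs t\<close> stands for the observation constraint at time \<open>t \<in> {0..T}\<close> and \<open>Flow t\<close> for the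
  mass-conservation constraint at time \<open>t \<in> {1..<T}\<close>. The unknown is \<open>M 0, \<dots>, M (T - 1)\<close>.
\<close>

datatype constr = Obs nat | Flow nat

definition flow_dom :: "nat \<Rightarrow> nat \<Rightarrow> (nat \<Rightarrow> real mat) \<Rightarrow> real vec \<Rightarrow> (nat \<Rightarrow> real mat) set" where
  "flow_dom n T A mu = {M. (\<forall>t<T. M t \<in> carrier_mat n n \<and> nonneg_mat (M t)) \<and>
     supp_mat (M 0) \<subseteq> supp_mat (diag_of mu * A 0) \<and>
     (\<forall>t\<in>{1..<T}. supp_mat (M t) \<subseteq> supp_mat (A t))}"

definition flow_obj :: "nat \<Rightarrow> nat \<Rightarrow> (nat \<Rightarrow> real mat) \<Rightarrow> real vec \<Rightarrow> (nat \<Rightarrow> real mat) \<Rightarrow> real" where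
  "flow_obj n T A mu M = kl_div (M 0) (diag_of mu * A 0) +
     (\<Sum>t\<in>{1..<T}. kl_div (M t) (diag_of (M t *\<^sub>v ones n) * A t))"

fun flow_res ::
  "nat \<Rightarrow> nat \<Rightarrow> real mat \<Rightarrow> (nat \<Rightarrow> real vec) \<Rightarrow> (nat \<Rightarrow> real mat) \<Rightarrow> constr \<Rightarrow> real vec" where
  "flow_res n T C rho M (Obs t) =
     (if t < T then rho t - C *\<^sub>v (M t *\<^sub>v ones n)
      else rho T - C *\<^sub>v (transpose_mat (M (T - 1)) *\<^sub>v ones n))"
| "flow_res n T C rho M (Flow t) = M t *\<^sub>v ones n - transpose_mat (M (t - 1)) *\<^sub>v ones n"

definition flow_program ::
  "nat \<Rightarrow> nat \<Rightarrow> (nat \<Rightarrow> real mat) \<Rightarrow> real mat \<Rightarrow> (nat \<Rightarrow> real vec) \<Rightarrow> real vec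
   \<Rightarrow> (nat \<Rightarrow> real mat, constr) eq_program" where
  "flow_program n T A C rho mu =
     \<lparr> ep_dom = flow_dom n T A mu,
       ep_obj = flow_obj n T A mu,
       ep_idx = Obs ` {0..T} \<union> Flow ` {1..<T},
       ep_dim = (\<lambda>c. case c of Obs _ \<Rightarrow> dim_row C | Flow _ \<Rightarrow> n),
       ep_res = flow_res n T C rho \<rparr>"

lemma vec_diff_eq_0_iff:
  fixes v w :: "real vec"
  assumes "v \<in> carrier_vec n" "w \<in> carrier_vec n"
  shows "v - w = 0\<^sub>v n \<longleftrightarrow> w = v"
  using assms by (auto simp: vec_eq_iff)

lemma flow_program_feasible_iff:
  assumes "T \<ge> 1" "C \<in> carrier_mat k n" "\<forall>t\<le>T. rho t \<in> carrier_vec k"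
  shows "M \<in> ep_feasible (flow_program n T A C rho mu) \<longleftrightarrow>
     M \<in> flow_dom n T A mu \<and>
     (\<forall>t<T. C *\<^sub>v (M t *\<^sub>v ones n) = rho t) \<and>
     C *\<^sub>v (transpose_mat (M (T - 1)) *\<^sub>v ones n) = rho T \<and>
     (\<forall>t\<in>{1..<T}. M t *\<^sub>v ones n = transpose_mat (M (t - 1)) *\<^sub>v ones n)"
proof (cases "M \<in> flow_dom n T A mu")
  case True
  then have M: "M t \<in> carrier_mat n n" if "t < T" for t
    using that by (simp add: flow_dom_def)
  have Cv: "C *\<^sub>v x \<in> carrier_vec k" for x
    using assms(2) by (intro carrier_vecI) simp
  have obs: "(flow_res n T C rho M (Obs t) = 0\<^sub>v k) = (C *\<^sub>v (M t *\<^sub>v ones n) = rho t)" if "t < T" for t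
    using that assms(3) Cv by (simp add: vec_diff_eq_0_iff)
  have obsT: "(flow_res n T C rho M (Obs T) = 0\<^sub>v k) =
      (C *\<^sub>v (transpose_mat (M (T - 1)) *\<^sub>v ones n) = rho T)"
    using assms(3) Cv by (simp add: vec_diff_eq_0_iff)
  have flow: "(flow_res n T C rho M (Flow t) = 0\<^sub>v n) =
      (M t *\<^sub>v ones n = transpose_mat (M (t - 1)) *\<^sub>v ones n)" if "t \<in> {1..<T}" for t
  proof -
    have t: "t < T" "t - 1 < T" using that by auto
    have "M t *\<^sub>v ones n \<in> carrier_vec n" "transpose_mat (M (t - 1)) *\<^sub>v ones n \<in> carrier_vec n"
      using M[OF t(1)] M[OF t(2)] by (auto intro!: carrier_vecI)
    from vec_diff_eq_0_iff[OF this] show ?thesis unfolding flow_res.simps by metis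
  qed
  have "M \<in> ep_feasible (flow_program n T A C rho mu) \<longleftrightarrow>
      (\<forall>t\<in>{0..T}. flow_res n T C rho M (Obs t) = 0\<^sub>v k) \<and>
      (\<forall>t\<in>{1..<T}. flow_res n T C rho M (Flow t) = 0\<^sub>v n)"
    using True assms(2)
    by (simp add: ep_feasible_def flow_program_def ball_Un del: flow_res.simps)
  moreover have "{0..T} = insert T {..<T}"
    by auto
  ultimately show ?thesis
    using True obs obsT flow by (auto simp del: flow_res.simps)
next
  case False
  then show ?thesis by (simp add: ep_feasible_def flow_program_def)
qed


section \<open>The reduced dual objective\<close>

definition scaling :: "real mat \<Rightarrow> (nat \<Rightarrow> real vec) \<Rightarrow> nat \<Rightarrow> real vec" where
  "scaling C lam t = map_vec exp (transpose_mat C *\<^sub>v lam t)"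

text \<open>\<open>chain T A u = diag (u 0) A\<^sub>0 diag (u 1) A\<^sub>1 \<dots> diag (u (T-1)) A\<^sub>T\<^sub>-\<^sub>1 u T\<close>\<close>

definition chain :: "nat \<Rightarrow> (nat \<Rightarrow> real mat) \<Rightarrow> (nat \<Rightarrow> real vec) \<Rightarrow> real vec" where
  "chain T A u = foldr (\<lambda>t v. (diag_of (u t) * A t) *\<^sub>v v) [0..<T] (u T)"

text \<open>
  Maximising the Lagrangian dual function over the multipliers of the \<open>Flow\<close> constraints gives
  \<open>reduced_dual\<close> plus the total mass of \<open>mu\<close>. This constant does not depend on \<open>lam\<close>; it comes
  from the summand \<open>+ q\<close> of the divergence: the minimum of \<open>p log (p / q) - p + q - c p\<close> over
  \<open>p \<ge> 0\<close> is \<open>q - q exp c\<close>, not \<open>- q exp c\<close>.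
\<close>

definition reduced_dual ::
  "nat \<Rightarrow> (nat \<Rightarrow> real mat) \<Rightarrow> real mat \<Rightarrow> (nat \<Rightarrow> real vec) \<Rightarrow> real vec \<Rightarrow> (nat \<Rightarrow> real vec) \<Rightarrow> real"
  where
  "reduced_dual T A C rho mu lam =
     (\<Sum>t\<le>T. lam t \<bullet> rho t) - mu \<bullet> chain T A (scaling C lam)"

definition obs_multipliers :: "nat \<Rightarrow> nat \<Rightarrow> (nat \<Rightarrow> real vec) set" where
  "obs_multipliers k T = {lam. \<forall>t\<le>T. lam t \<in> carrier_vec k}"

definition flow_multipliers :: "nat \<Rightarrow> nat \<Rightarrow> (nat \<Rightarrow> real vec) set" where
  "flow_multipliers n T = {nu. \<forall>t\<in>{1..<T}. nu t \<in> carrier_vec n}"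

end

theory Submission
  imports Defs
begin

text \<open>
  For fixed observation multipliers, the Lagrangian has an explicit saddle point in the primal
  variable and the flow multipliers. Put \<open>V t = diag (u t) A\<^sub>t \<dots> u T\<close> and
  \<open>nu t = ln (V t)\<close>. With these flow multipliers every summand of the Lagrangian has the form
  \<open>\<Sum> p ln (p / q) - p + q - c p\<close>, which is at least \<open>\<Sum> q (1 - exp c)\<close>. Since
  \<open>exp c\<close> turns \<open>A\<^sub>t\<close> into a row-stochastic matrix for \<open>t \<ge> 1\<close>, this bound vanishes there, and
  for \<open>t = 0\<close> it is the mass of \<open>mu\<close> minus \<open>mu \<bullet> V 0\<close>. Equality holds for the Markov
  flow \<open>M\<close> started in \<open>mu\<close> with the tilted transition matrices. That flow conserves mass, so its
  Lagrangian does not depend on the flow multipliers, and it bounds the dual function from above for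
  all of them at once.
\<close>

section \<open>Minimising a divergence minus a linear term, entry by entry\<close>

text \<open>For positive \<open>p\<close> this is \<open>ln x \<le> x - 1\<close> at
  \<open>x = q * exp c / p\<close>, multiplied by \<open>p\<close>. Equality means
  \<open>x = 1\<close>, so the minimiser is \<open>p = q * exp c\<close>, the point evaluated in
  \<open>kl_term_eq\<close>. The last hypothesis is support inclusion for a single entry.\<close>

lemma kl_term_ge:
  fixes p q c :: real
  assumes "p \<ge> 0" "q \<ge> 0" "p \<noteq> 0 \<Longrightarrow> q \<noteq> 0"
  shows "q * (1 - exp c) \<le> p * ln (p / q) - p + q - c * p"
proof (cases "p = 0")
  case True
  then show ?thesis using assms by (simp add: algebra_simps)
next
  case False
  then have p: "p > 0" and q: "q > 0" using assms by auto
  have "ln (q * exp c / p) \<le> q * exp c / p - 1"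
    using p q by (intro ln_le_minus_one) simp
  then have "p * ln (q * exp c / p) \<le> p * (q * exp c / p - 1)"
    using p by (simp only: mult_le_cancel_left_pos)
  then show ?thesis
    using p q by (simp add: ln_div ln_mult algebra_simps)
qed

lemma kl_term_eq:
  fixes q c :: real
  shows "q * exp c * ln (q * exp c / q) - q * exp c + q - c * (q * exp c) = q * (1 - exp c)"
  by (cases "q = 0") (simp_all add: algebra_simps)

lemma kl_div_tilted_ge:
  assumes "P \<in> carrier_mat n n" "Q \<in> carrier_mat n n" "nonneg_mat P" "nonneg_mat Q"
    and "supp_mat P \<subseteq> supp_mat Q"
  shows "(\<Sum>i<n. \<Sum>j<n. Q $$ (i, j) * (1 - exp (c i j)))
    \<le> kl_div P Q - (\<Sum>i<n. \<Sum>j<n. c i j * P $$ (i, j))"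
proof -
  have "(\<Sum>i<n. \<Sum>j<n. Q $$ (i, j) * (1 - exp (c i j)))
    \<le> (\<Sum>i<n. \<Sum>j<n. P $$ (i, j) * ln (P $$ (i, j) / Q $$ (i, j)) - P $$ (i, j) + Q $$ (i, j)
        - c i j * P $$ (i, j))"
  proof (intro sum_mono kl_term_ge)
    fix i j assume ij: "i \<in> {..<n}" "j \<in> {..<n}"
    show "0 \<le> P $$ (i, j)" "0 \<le> Q $$ (i, j)"
      using assms ij by (auto simp: nonneg_mat_def)
    show "Q $$ (i, j) \<noteq> 0" if "P $$ (i, j) \<noteq> 0"
      using assms ij that by (auto simp: supp_mat_def)
  qed
  also have "\<dots> = kl_div P Q - (\<Sum>i<n. \<Sum>j<n. c i j * P $$ (i, j))"
    using assms by (simp add: kl_div_def sum_subtractf)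
  finally show ?thesis .
qed

lemma kl_div_tilted_eq:
  assumes "P \<in> carrier_mat n n"
    and "\<And>i j. i < n \<Longrightarrow> j < n \<Longrightarrow> P $$ (i, j) = Q $$ (i, j) * exp (c i j)"
  shows "kl_div P Q - (\<Sum>i<n. \<Sum>j<n. c i j * P $$ (i, j))
    = (\<Sum>i<n. \<Sum>j<n. Q $$ (i, j) * (1 - exp (c i j)))"
proof -
  have "kl_div P Q - (\<Sum>i<n. \<Sum>j<n. c i j * P $$ (i, j))
    = (\<Sum>i<n. \<Sum>j<n. P $$ (i, j) * ln (P $$ (i, j) / Q $$ (i, j)) - P $$ (i, j) + Q $$ (i, j)
        - c i j * P $$ (i, j))"
    using assms(1) by (simp add: kl_div_def sum_subtractf)
  also have "\<dots> = (\<Sum>i<n. \<Sum>j<n. Q $$ (i, j) * (1 - exp (c i j)))"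
    by (intro sum.cong refl) (simp only: assms(2) kl_term_eq lessThan_iff)
  finally show ?thesis .
qed

section \<open>Matrix products written as finite sums\<close>

lemma index_diag_of_mult:
  assumes "A \<in> carrier_mat n m" "v \<in> carrier_vec n" "i < n" "j < m"
  shows "(diag_of v * A) $$ (i, j) = v $ i * A $$ (i, j)"
  using assms by (simp add: diag_of_def mat_diag_mult_left[where n = n])

lemma diag_of_mult_carrier:
  assumes "A \<in> carrier_mat n m" "v \<in> carrier_vec n"
  shows "diag_of v * A \<in> carrier_mat n m"
  using assms by (auto simp: diag_of_def mat_diag_def)

lemma row_dot_ones:
  assumes "M \<in> carrier_mat m n" "i < m"
  shows "row M i \<bullet> ones n = (\<Sum>j<n. M $$ (i, j))"
  using assms by (simp add: ones_def scalar_prod_def atLeast0LessThan)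

lemma col_dot_ones:
  assumes "M \<in> carrier_mat n m" "j < m"
  shows "col M j \<bullet> ones n = (\<Sum>i<n. M $$ (i, j))"
  using assms by (simp add: ones_def scalar_prod_def atLeast0LessThan)

text \<open>Moves \<open>C\<close> onto the multiplier, so that observation terms become linear in
  the entries of the unknown matrices.\<close>

lemma scalar_prod_adjoint:
  fixes C :: "real mat"
  assumes "C \<in> carrier_mat k n" "l \<in> carrier_vec k" "x \<in> carrier_vec n"
  shows "l \<bullet> (C *\<^sub>v x) = (\<Sum>i<n. (transpose_mat C *\<^sub>v l) $ i * x $ i)"
proof -
  have "l \<bullet> (C *\<^sub>v x) = (\<Sum>r<k. \<Sum>i<n. l $ r * (C $$ (r, i) * x $ i))"
    using assms by (simp add: scalar_prod_def atLeast0LessThan sum_distrib_left)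
  also have "\<dots> = (\<Sum>i<n. \<Sum>r<k. l $ r * (C $$ (r, i) * x $ i))"
    by (rule sum.swap)
  also have "\<dots> = (\<Sum>i<n. (transpose_mat C *\<^sub>v l) $ i * x $ i)"
    using assms
    by (simp add: scalar_prod_def atLeast0LessThan sum_distrib_left mult_ac)
  finally show ?thesis .
qed

lemma row_stochastic_row_sum:
  assumes "row_stochastic n A" "i < n"
  shows "(\<Sum>j<n. A $$ (i, j)) = 1"
proof -
  have A: "A \<in> carrier_mat n n" "A *\<^sub>v ones n = ones n"
    using assms(1) by (auto simp: row_stochastic_def)
  have "(\<Sum>j<n. A $$ (i, j)) = (A *\<^sub>v ones n) $ i"
    using A(1) assms(2) by (simp add: row_dot_ones)
  also have "\<dots> = 1"
    unfolding A(2) using assms(2) by (simp add: ones_def)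
  finally show ?thesis .
qed

lemma nonneg_transpose_coord_sel_mult:
  assumes "v \<in> carrier_vec (length ps)" "nonneg_vec v" "i < n"
  shows "0 \<le> (transpose_mat (coord_sel n ps) *\<^sub>v v) $ i"
  using assms
  by (auto simp: coord_sel_def nonneg_vec_def scalar_prod_def intro!: sum_nonneg)

section \<open>Backward recursion for the scaled matrix product\<close>

text \<open>\<open>chain\<close> is the case \<open>t = 0\<close>; a free starting time permits
  induction backwards from \<open>T\<close>.\<close>

definition tail_chain :: "nat \<Rightarrow> (nat \<Rightarrow> real mat) \<Rightarrow> (nat \<Rightarrow> real vec) \<Rightarrow> nat \<Rightarrow> real vec" where
  "tail_chain T A u t = foldr (\<lambda>s v. (diag_of (u s) * A s) *\<^sub>v v) [t..<T] (u T)"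

lemma tail_chain_final: "tail_chain T A u T = u T"
  by (simp add: tail_chain_def)

lemma tail_chain_step:
  "t < T \<Longrightarrow> tail_chain T A u t = (diag_of (u t) * A t) *\<^sub>v tail_chain T A u (Suc t)"
  by (simp add: tail_chain_def upt_conv_Cons)

locale dual_flow =
  fixes n T k :: nat
    and A :: "nat \<Rightarrow> real mat"
    and C :: "real mat"
    and rho lam :: "nat \<Rightarrow> real vec"
    and mu :: "real vec"
  assumes T_pos: "T \<ge> 1"
    and stochastic: "\<And>t. t < T \<Longrightarrow> row_stochastic n (A t)"
    and C_carrier: "C \<in> carrier_mat k n"
    and rho_carrier: "\<And>t. t \<le> T \<Longrightarrow> rho t \<in> carrier_vec k"
    and lam_carrier: "\<And>t. t \<le> T \<Longrightarrow> lam t \<in> carrier_vec k"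
    and mu_carrier: "mu \<in> carrier_vec n"
    and mu_nonneg: "\<And>i. i < n \<Longrightarrow> 0 \<le> mu $ i"
begin

definition pull :: "nat \<Rightarrow> nat \<Rightarrow> real" where
  "pull t i = (transpose_mat C *\<^sub>v lam t) $ i"

text \<open>
  The flow multipliers, extended by \<open>0\<close> at time \<open>0\<close> and by the terminal observation multiplier at
  time \<open>T\<close>, so that all summands of the Lagrangian have the same shape.
\<close>

definition pot :: "(nat \<Rightarrow> real vec) \<Rightarrow> nat \<Rightarrow> nat \<Rightarrow> real" where
  "pot nu t i = (if t = 0 then 0 else if t = T then pull T i else nu t $ i)"

text \<open>Minus the coefficient of entry \<open>(i, j)\<close> of \<open>M t\<close> in the
  multiplier part of the Lagrangian. It plays the role of \<open>c\<close> in
  \<open>kl_term_ge\<close>.\<close>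

definition gain :: "(nat \<Rightarrow> real vec) \<Rightarrow> nat \<Rightarrow> nat \<Rightarrow> nat \<Rightarrow> real" where
  "gain nu t i j = pull t i + pot nu (Suc t) j - pot nu t i"

definition V :: "nat \<Rightarrow> nat \<Rightarrow> real" where
  "V t i = tail_chain T A (scaling C lam) t $ i"

definition opt_nu :: "nat \<Rightarrow> real vec" where
  "opt_nu t = vec n (\<lambda>i. ln (V t i))"

text \<open>The row weights of the reference matrix in the divergence at time \<open>t\<close>.
  Treating time \<open>0\<close> here turns the objective into one uniform sum
  (\<open>flow_obj_eq\<close>).\<close>

definition source :: "(nat \<Rightarrow> real mat) \<Rightarrow> nat \<Rightarrow> real vec" where
  "source M t = (if t = 0 then mu else M t *\<^sub>v ones n)"

abbreviation "prog \<equiv> flow_program n T A C rho mu"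

lemma A_carrier: "t < T \<Longrightarrow> A t \<in> carrier_mat n n"
  using stochastic by (simp add: row_stochastic_def)

lemma A_nonneg: "t < T \<Longrightarrow> i < n \<Longrightarrow> j < n \<Longrightarrow> 0 \<le> A t $$ (i, j)"
  using stochastic[of t] by (auto simp: row_stochastic_def nonneg_mat_def)

lemma scaling_carrier: "scaling C lam t \<in> carrier_vec n"
  using C_carrier by (auto simp: scaling_def intro!: carrier_vecI)

lemma scaling_index: "i < n \<Longrightarrow> scaling C lam t $ i = exp (pull t i)"
  using C_carrier by (simp add: scaling_def pull_def)

lemma tail_chain_carrier: "t \<le> T \<Longrightarrow> tail_chain T A (scaling C lam) t \<in> carrier_vec n"
proof (induction t rule: inc_induct)
  case base
  then show ?case by (simp add: tail_chain_final scaling_carrier)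
next
  case (step t)
  then show ?case
    using diag_of_mult_carrier[OF A_carrier scaling_carrier, of t t]
    by (simp add: tail_chain_step)
qed

lemma V_final: "i < n \<Longrightarrow> V T i = exp (pull T i)"
  by (simp add: V_def tail_chain_final scaling_index)

lemma V_step:
  assumes "t < T" "i < n"
  shows "V t i = exp (pull t i) * (\<Sum>j<n. A t $$ (i, j) * V (Suc t) j)"
proof -
  note D = diag_of_mult_carrier[OF A_carrier[OF assms(1)] scaling_carrier, of t]
  have "V t i = (\<Sum>j<n. (diag_of (scaling C lam t) * A t) $$ (i, j) * V (Suc t) j)"
    unfolding V_def tail_chain_step[OF assms(1)]
    using assms D tail_chain_carrier[of "Suc t"]
    by (simp add: scalar_prod_def atLeast0LessThan row_def del: index_mult_mat)
  then show ?thesis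
    using assms
    by (simp add: index_diag_of_mult[OF A_carrier scaling_carrier] scaling_index
        sum_distrib_left mult.assoc)
qed

text \<open>Each row of a stochastic matrix has a positive entry, so positivity propagates backwards
  from the exponential at time \<open>T\<close>. This makes the logarithm in \<open>opt_nu\<close>
  meaningful.\<close>

lemma V_pos: "t \<le> T \<Longrightarrow> i < n \<Longrightarrow> 0 < V t i"
proof (induction t arbitrary: i rule: inc_induct)
  case base
  then show ?case by (simp add: V_final)
next
  case (step t)
  have "\<exists>j<n. A t $$ (i, j) > 0"
  proof (rule ccontr)
    assume "\<not> ?thesis"
    then have "(\<Sum>j<n. A t $$ (i, j)) \<le> 0" by (intro sum_nonpos) (meson lessThan_iff not_less)
    then show False using row_stochastic_row_sum[OF stochastic] step by simp
  qed
  then obtain j where j: "j < n" "A t $$ (i, j) > 0" by blast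
  have "0 < (\<Sum>j<n. A t $$ (i, j) * V (Suc t) j)"
  proof (rule sum_pos2[where i = j])
    show "0 < A t $$ (i, j) * V (Suc t) j"
      using j step.IH by (intro mult_pos_pos)
    show "0 \<le> A t $$ (i, j') * V (Suc t) j'" if "j' \<in> {..<n}" for j'
      using that step by (intro mult_nonneg_nonneg A_nonneg) (auto intro: less_imp_le)
  qed (use j in auto)
  then show ?case using step by (simp add: V_step)
qed

lemma pot_opt_nu:
  assumes "1 \<le> t" "t \<le> T" "i < n"
  shows "pot opt_nu t i = ln (V t i)"
  using assms by (simp add: pot_def opt_nu_def V_final)

text \<open>A Doob transform: for \<open>t \<ge> 1\<close> the factor
  \<open>exp (gain opt_nu t i j)\<close> equals \<open>exp (pull t i) * V (Suc t) j / V t i\<close>,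
  and \<open>V_step\<close> says that these weights normalise the row. At \<open>t = 0\<close> the
  potential is \<open>0\<close>, so the division by \<open>V 0 i\<close> is missing.\<close>

lemma tilted_row_sum:
  assumes "t < T" "i < n"
  shows "(\<Sum>j<n. A t $$ (i, j) * exp (gain opt_nu t i j)) = (if t = 0 then V 0 i else 1)"
proof -
  have "(\<Sum>j<n. A t $$ (i, j) * exp (gain opt_nu t i j))
    = (\<Sum>j<n. exp (pull t i) / exp (pot opt_nu t i) * (A t $$ (i, j) * V (Suc t) j))"
    using assms
    by (intro sum.cong refl) (simp add: gain_def exp_add exp_diff pot_opt_nu V_pos)
  also have "\<dots> = V t i / exp (pot opt_nu t i)"
    using assms by (simp add: V_step sum_distrib_left sum_divide_distrib)
  also have "\<dots> = (if t = 0 then V 0 i else 1)"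
    using assms V_pos[of t i] by (cases "t = 0") (simp_all add: pot_opt_nu, simp add: pot_def)
  finally show ?thesis .
qed

lemma source_carrier: "t < T \<Longrightarrow> M t \<in> carrier_mat n n \<Longrightarrow> source M t \<in> carrier_vec n"
  using mu_carrier by (simp add: source_def mult_mat_vec_carrier[where n = n] ones_def)

text \<open>Row \<open>i\<close> contributes \<open>w $ i\<close> times the difference of the
  original and the tilted row sum. For \<open>t \<ge> 1\<close> both are \<open>1\<close>, so the
  value does not depend on \<open>w\<close>; the reference weights may therefore depend on the
  unknown \<open>M t\<close>.\<close>

lemma tilted_mass:
  assumes "t < T" "w \<in> carrier_vec n"
  shows "(\<Sum>i<n. \<Sum>j<n. (diag_of w * A t) $$ (i, j) * (1 - exp (gain opt_nu t i j)))
    = (if t = 0 then \<Sum>i<n. w $ i * (1 - V 0 i) else 0)"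
proof -
  have "(\<Sum>j<n. (diag_of w * A t) $$ (i, j) * (1 - exp (gain opt_nu t i j)))
      = w $ i * (1 - (if t = 0 then V 0 i else 1))" if "i < n" for i
  proof -
    have "(\<Sum>j<n. (diag_of w * A t) $$ (i, j) * (1 - exp (gain opt_nu t i j)))
      = w $ i * ((\<Sum>j<n. A t $$ (i, j)) - (\<Sum>j<n. A t $$ (i, j) * exp (gain opt_nu t i j)))"
      using that assms
      by (simp add: index_diag_of_mult[OF A_carrier] sum_subtractf[symmetric] sum_distrib_left
          right_diff_distrib mult.assoc)
    then show ?thesis
      using that assms by (simp add: tilted_row_sum row_stochastic_row_sum[OF stochastic])
  qed
  then show ?thesis by simp
qed

lemma reduced_dual_eq:
  "reduced_dual T A C rho mu lam + ones n \<bullet> mu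
    = (\<Sum>t\<le>T. lam t \<bullet> rho t) + (\<Sum>i<n. mu $ i * (1 - V 0 i))"
proof -
  have "dim_vec (chain T A (scaling C lam)) = n"
    using tail_chain_carrier[of 0] by (simp add: tail_chain_def chain_def)
  then have "mu \<bullet> chain T A (scaling C lam) = (\<Sum>i<n. mu $ i * V 0 i)"
    by (simp add: scalar_prod_def V_def tail_chain_def chain_def atLeast0LessThan)
  moreover have "ones n \<bullet> mu = (\<Sum>i<n. mu $ i)"
    using mu_carrier by (simp add: scalar_prod_def ones_def atLeast0LessThan)
  ultimately show ?thesis
    by (simp add: reduced_dual_def right_diff_distrib sum_subtractf)
qed

section \<open>Rewriting the Lagrangian as a sum over times\<close>

lemma obs_term:
  assumes "t < T" "M t \<in> carrier_mat n n"
  shows "lam t \<bullet> flow_res n T C rho M (Obs t)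
    = lam t \<bullet> rho t - (\<Sum>i<n. \<Sum>j<n. pull t i * M t $$ (i, j))"
proof -
  have v: "M t *\<^sub>v ones n \<in> carrier_vec n" using assms by (auto intro!: carrier_vecI)
  have "lam t \<bullet> flow_res n T C rho M (Obs t) = lam t \<bullet> rho t - lam t \<bullet> (C *\<^sub>v (M t *\<^sub>v ones n))"
    using assms C_carrier rho_carrier[of t] lam_carrier[of t] v
    by (simp add: scalar_prod_minus_distrib[where n = k])
  then show ?thesis
    using assms v
    by (simp add: scalar_prod_adjoint[OF C_carrier lam_carrier] pull_def row_dot_ones
        sum_distrib_left)
qed

lemma obs_term_final:
  assumes "M (T - 1) \<in> carrier_mat n n"
  shows "lam T \<bullet> flow_res n T C rho M (Obs T)
    = lam T \<bullet> rho T - (\<Sum>i<n. \<Sum>j<n. pull T j * M (T - 1) $$ (i, j))"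
proof -
  have v: "transpose_mat (M (T - 1)) *\<^sub>v ones n \<in> carrier_vec n"
    using assms by (auto intro!: carrier_vecI)
  have "lam T \<bullet> flow_res n T C rho M (Obs T)
      = lam T \<bullet> rho T - lam T \<bullet> (C *\<^sub>v (transpose_mat (M (T - 1)) *\<^sub>v ones n))"
    using assms C_carrier rho_carrier[of T] lam_carrier[of T] v
    by (simp add: scalar_prod_minus_distrib[where n = k])
  also have "\<dots> = lam T \<bullet> rho T - (\<Sum>j<n. \<Sum>i<n. pull T j * M (T - 1) $$ (i, j))"
    using assms v
    by (simp add: scalar_prod_adjoint[OF C_carrier lam_carrier] pull_def col_dot_ones
        sum_distrib_left)
  finally show ?thesis by (subst sum.swap)
qed

lemma flow_term:
  assumes "M t \<in> carrier_mat n n" "M (t - 1) \<in> carrier_mat n n" "nu t \<in> carrier_vec n"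
  shows "nu t \<bullet> flow_res n T C rho M (Flow t)
    = (\<Sum>i<n. \<Sum>j<n. nu t $ i * M t $$ (i, j)) - (\<Sum>i<n. \<Sum>j<n. nu t $ j * M (t - 1) $$ (i, j))"
proof -
  have "nu t \<bullet> flow_res n T C rho M (Flow t)
    = (\<Sum>i<n. nu t $ i * ((M t *\<^sub>v ones n) $ i - (transpose_mat (M (t - 1)) *\<^sub>v ones n) $ i))"
    using assms by (simp add: scalar_prod_def atLeast0LessThan)
  also have "\<dots> = (\<Sum>i<n. \<Sum>j<n. nu t $ i * M t $$ (i, j))
      - (\<Sum>j<n. \<Sum>i<n. nu t $ j * M (t - 1) $$ (i, j))"
    using assms
    by (simp add: row_dot_ones col_dot_ones right_diff_distrib sum_subtractf
        sum_distrib_left)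
  finally show ?thesis by (subst (2) sum.swap)
qed

lemma flow_obj_eq:
  "flow_obj n T A mu M = (\<Sum>t<T. kl_div (M t) (diag_of (source M t) * A t))"
proof -
  have "{..<T} = insert 0 {1..<T}" using T_pos by auto
  then show ?thesis by (simp add: flow_obj_def source_def)
qed

text \<open>Summation by parts in time: \<open>nu t\<close> meets the rows of \<open>M t\<close> and
  the columns of \<open>M (t - 1)\<close>. Regrouping by matrix instead of by constraint collects
  the coefficient \<open>gain\<close>.\<close>

lemma lagrangian_eq:
  assumes M: "\<And>t. t < T \<Longrightarrow> M t \<in> carrier_mat n n" and nu: "nu \<in> flow_multipliers n T"
  shows "lagrangian prog M (case_constr lam nu) = (\<Sum>t\<le>T. lam t \<bullet> rho t)
    + (\<Sum>t<T. kl_div (M t) (diag_of (source M t) * A t)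
        - (\<Sum>i<n. \<Sum>j<n. gain nu t i j * M t $$ (i, j)))"
proof -
  obtain S where S: "T = Suc S" using T_pos by (cases T) auto
  \<comment> \<open>Pairings of \<open>M t\<close> with the observation multiplier
    (\<open>p\<close>), with the potential at time \<open>t\<close> on its rows (\<open>r\<close>),
    and with the potential at time \<open>Suc t\<close> on its columns (\<open>c\<close>).\<close>
  define p where "p t = (\<Sum>i<n. \<Sum>j<n. pull t i * M t $$ (i, j))" for t
  define r where "r t = (\<Sum>i<n. \<Sum>j<n. pot nu t i * M t $$ (i, j))" for t
  define c where "c t = (\<Sum>i<n. \<Sum>j<n. pot nu (Suc t) j * M t $$ (i, j))" for t
  have gain: "(\<Sum>i<n. \<Sum>j<n. gain nu t i j * M t $$ (i, j)) = p t + c t - r t" for t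
    by (simp add: gain_def p_def r_def c_def algebra_simps sum.distrib sum_subtractf)
  have "(\<Sum>x\<in>Obs ` {0..T}. case_constr lam nu x \<bullet> flow_res n T C rho M x)
      = (\<Sum>t\<le>T. lam t \<bullet> flow_res n T C rho M (Obs t))"
    by (subst sum.reindex) (auto simp: inj_on_def atLeast0AtMost)
  also have "\<dots> = (\<Sum>t<T. lam t \<bullet> rho t - p t) + (lam T \<bullet> rho T - c S)"
  proof -
    have "(\<Sum>t<T. lam t \<bullet> flow_res n T C rho M (Obs t)) = (\<Sum>t<T. lam t \<bullet> rho t - p t)"
      by (intro sum.cong refl) (simp add: obs_term M p_def del: flow_res.simps)
    moreover have "lam T \<bullet> flow_res n T C rho M (Obs T) = lam T \<bullet> rho T - c S"
    proof -
      \<comment> \<open>The terminal observation sees the column sums of the last matrix, so it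
        supplies the column term that no flow constraint provides.\<close>
      have "c S = (\<Sum>i<n. \<Sum>j<n. pull T j * M (T - 1) $$ (i, j))"
        unfolding c_def pot_def S[symmetric] using S by simp
      then show ?thesis using obs_term_final[of M] M[of "T - 1"] T_pos by simp
    qed
    ultimately show ?thesis by (simp add: lessThan_Suc_atMost[symmetric] del: flow_res.simps)
  qed
  finally have obs: "(\<Sum>x\<in>Obs ` {0..T}. case_constr lam nu x \<bullet> flow_res n T C rho M x)
      = (\<Sum>t\<le>T. lam t \<bullet> rho t) - (\<Sum>t<T. p t) - c S"
    by (simp add: sum_subtractf lessThan_Suc_atMost[symmetric])
  have "(\<Sum>x\<in>Flow ` {1..<T}. case_constr lam nu x \<bullet> flow_res n T C rho M x)
      = (\<Sum>t\<in>{1..<T}. nu t \<bullet> flow_res n T C rho M (Flow t))"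
    by (subst sum.reindex) (auto simp: inj_on_def)
  also have "\<dots> = (\<Sum>t\<in>{1..<T}. r t - c (t - 1))"
    using nu by (intro sum.cong)
      (auto simp: flow_term M flow_multipliers_def r_def c_def pot_def simp del: flow_res.simps)
  also have "\<dots> = (\<Sum>t\<in>{Suc 0..<Suc S}. r t - c (t - 1))"
    by (simp add: S)
  \<comment> \<open>Shifting the index by one aligns the column term of \<open>M (t - 1)\<close>
    with its own time.\<close>
  also have "\<dots> = (\<Sum>t<S. r (Suc t) - c t)"
    by (simp only: sum.shift_bounds_Suc_ivl atLeast0LessThan diff_Suc_1)
  also have "\<dots> = (\<Sum>t<S. r (Suc t)) - (\<Sum>t<S. c t)"
    by (simp add: sum_subtractf)
  also have "(\<Sum>t<S. r (Suc t)) = (\<Sum>t<T. r t)"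
  proof -
    \<comment> \<open>The potential at time \<open>0\<close> is zero, so the row sum may start at
      \<open>0\<close> although flow constraints start at \<open>1\<close>.\<close>
    have "r 0 = 0" by (simp add: r_def pot_def)
    then show ?thesis by (simp add: S sum.lessThan_Suc_shift del: sum.lessThan_Suc)
  qed
  finally have flow: "(\<Sum>x\<in>Flow ` {1..<T}. case_constr lam nu x \<bullet> flow_res n T C rho M x)
      = (\<Sum>t<T. r t) - (\<Sum>t<S. c t)" .
  have L: "lagrangian prog M (case_constr lam nu)
      = flow_obj n T A mu M
        + (\<Sum>x\<in>Obs ` {0..T}. case_constr lam nu x \<bullet> flow_res n T C rho M x)
        + (\<Sum>x\<in>Flow ` {1..<T}. case_constr lam nu x \<bullet> flow_res n T C rho M x)"
    unfolding lagrangian_def flow_program_def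
    by (simp only: eq_program.simps) (subst sum.union_disjoint, auto)
  have "(\<Sum>t<T. c t) = (\<Sum>t<S. c t) + c S"
    by (simp add: S)
  then show ?thesis
    unfolding L obs flow flow_obj_eq gain by (simp add: sum_subtractf sum.distrib)
qed

section \<open>The lower bound at the optimal flow multipliers\<close>

lemma lagrangian_ge:
  assumes "M \<in> flow_dom n T A mu"
  shows "reduced_dual T A C rho mu lam + ones n \<bullet> mu
    \<le> lagrangian prog M (case_constr lam opt_nu)"
proof -
  have M: "M t \<in> carrier_mat n n" "nonneg_mat (M t)" if "t < T" for t
    using assms that by (auto simp: flow_dom_def)
  have Q: "diag_of (source M t) * A t \<in> carrier_mat n n" if "t < T" for t
    using that by (intro diag_of_mult_carrier A_carrier source_carrier M)
  have Mij: "M t $$ (i, j) \<ge> 0" if "t < T" "i < n" "j < n" for t i j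
    using M[OF that(1)] that by (auto simp: nonneg_mat_def)
  have src: "source M t $ i \<ge> 0" if "t < T" "i < n" for t i
    using that mu_nonneg M(1)[OF that(1)] Mij
    by (auto simp: source_def row_dot_ones intro!: sum_nonneg)
  \<comment> \<open>For \<open>t \<ge> 1\<close> the domain only controls the support by
    \<open>A t\<close>. A nonzero entry of the nonnegative \<open>M t\<close> makes its row sum
    positive, so the factor \<open>diag_of (source M t)\<close> does not remove that entry.\<close>
  have supp: "supp_mat (M t) \<subseteq> supp_mat (diag_of (source M t) * A t)" if t: "t < T" for t
  proof (cases "t = 0")
    case True
    then show ?thesis using assms by (simp add: flow_dom_def source_def)
  next
    case False
    then have s: "supp_mat (M t) \<subseteq> supp_mat (A t)"
      using assms t by (auto simp: flow_dom_def)
    show ?thesis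
    proof (rule subrelI)
      fix i j assume ij: "(i, j) \<in> supp_mat (M t)"
      then have b: "i < n" "j < n" "M t $$ (i, j) \<noteq> 0" and a: "A t $$ (i, j) \<noteq> 0"
        using M[OF t] subsetD[OF s ij] by (auto simp: supp_mat_def)
      then have "0 < (\<Sum>j<n. M t $$ (i, j))"
        using Mij[OF t] by (intro sum_pos2[where i = j]) (auto simp: less_le)
      then have "source M t $ i \<noteq> 0"
        using False b M(1)[OF t] by (simp add: source_def row_dot_ones)
      then have "(diag_of (source M t) * A t) $$ (i, j) \<noteq> 0"
        using a b index_diag_of_mult[OF A_carrier source_carrier] t M by simp
      then show "(i, j) \<in> supp_mat (diag_of (source M t) * A t)"
        using b carrier_matD[OF Q[OF t]] by (simp add: supp_mat_def del: index_mult_mat)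
    qed
  qed
  have nonneg: "nonneg_mat (diag_of (source M t) * A t)" if t: "t < T" for t
    unfolding nonneg_mat_def carrier_matD[OF Q[OF t]]
    using t by (auto simp: index_diag_of_mult[OF A_carrier source_carrier] M src A_nonneg
        simp del: index_mult_mat)
  \<comment> \<open>Only time \<open>0\<close> contributes to the bound; spreading it over all times
    permits a termwise comparison.\<close>
  have "(\<Sum>i<n. mu $ i * (1 - V 0 i))
      = (\<Sum>t<T. if t = 0 then \<Sum>i<n. source M t $ i * (1 - V 0 i) else 0)"
    using T_pos by (simp add: source_def)
  also have "\<dots> \<le> (\<Sum>t<T. kl_div (M t) (diag_of (source M t) * A t)
        - (\<Sum>i<n. \<Sum>j<n. gain opt_nu t i j * M t $$ (i, j)))"
  proof (rule sum_mono)
    fix t assume "t \<in> {..<T}"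
    then have t: "t < T" by simp
    show "(if t = 0 then \<Sum>i<n. source M t $ i * (1 - V 0 i) else 0)
      \<le> kl_div (M t) (diag_of (source M t) * A t)
        - (\<Sum>i<n. \<Sum>j<n. gain opt_nu t i j * M t $$ (i, j))"
      using kl_div_tilted_ge[OF M(1)[OF t] Q[OF t] M(2)[OF t] nonneg[OF t] supp[OF t],
          of "gain opt_nu t"]
      unfolding tilted_mass[OF t source_carrier[of t M, OF t M(1)[OF t]]] .
  qed
  finally show ?thesis
    using lagrangian_eq[of M opt_nu] M
    by (simp add: reduced_dual_eq flow_multipliers_def opt_nu_def)
qed

section \<open>The tilted Markov flow that attains the bound\<close>

primrec marginal :: "nat \<Rightarrow> nat \<Rightarrow> real" where
  "marginal 0 = (\<lambda>i. mu $ i)"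
| "marginal (Suc t) =
    (\<lambda>j. \<Sum>i<n. marginal t i * A t $$ (i, j) * exp (gain opt_nu t i j))"

definition opt_flow :: "nat \<Rightarrow> real mat" where
  "opt_flow t = mat n n (\<lambda>(i, j). marginal t i * A t $$ (i, j) * exp (gain opt_nu t i j))"

lemma marginal_nonneg: "t \<le> T \<Longrightarrow> i < n \<Longrightarrow> 0 \<le> marginal t i"
  by (induction t arbitrary: i)
    (auto simp: mu_nonneg intro!: sum_nonneg mult_nonneg_nonneg A_nonneg)

lemma opt_flow_carrier: "opt_flow t \<in> carrier_mat n n"
  by (simp add: opt_flow_def)

lemma opt_flow_entry:
  "i < n \<Longrightarrow> j < n \<Longrightarrow>
    opt_flow t $$ (i, j) = marginal t i * A t $$ (i, j) * exp (gain opt_nu t i j)"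
  by (simp add: opt_flow_def)

text \<open>The tilted rows sum to \<open>1\<close> from time \<open>1\<close> on. At time
  \<open>0\<close> they sum to \<open>V 0 i\<close>, so the first row sums are
  \<open>mu $ i * V 0 i\<close> rather than \<open>marginal 0 i\<close>; no flow constraint involves
  them.\<close>

lemma opt_flow_row_sums:
  assumes "1 \<le> t" "t < T"
  shows "opt_flow t *\<^sub>v ones n = vec n (marginal t)"
proof (rule eq_vecI)
  fix i assume "i < dim_vec (vec n (marginal t))"
  then have i: "i < n" by simp
  have "(opt_flow t *\<^sub>v ones n) $ i
      = marginal t i * (\<Sum>j<n. A t $$ (i, j) * exp (gain opt_nu t i j))"
    using i by (simp add: carrier_matD[OF opt_flow_carrier] row_dot_ones[OF opt_flow_carrier]
        opt_flow_entry sum_distrib_left mult.assoc)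
  then show "(opt_flow t *\<^sub>v ones n) $ i = vec n (marginal t) $ i"
    using assms i by (simp add: tilted_row_sum)
qed (simp add: opt_flow_def)

lemma opt_flow_col_sums: "transpose_mat (opt_flow t) *\<^sub>v ones n = vec n (marginal (Suc t))"
proof (rule eq_vecI)
  fix j assume "j < dim_vec (vec n (marginal (Suc t)))"
  then show "(transpose_mat (opt_flow t) *\<^sub>v ones n) $ j = vec n (marginal (Suc t)) $ j"
    by (simp add: carrier_matD[OF opt_flow_carrier] col_dot_ones[OF opt_flow_carrier]
        opt_flow_entry)
qed (simp add: opt_flow_def)

lemma source_opt_flow: "t < T \<Longrightarrow> i < n \<Longrightarrow> source opt_flow t $ i = marginal t i"
  by (cases "t = 0") (simp_all add: source_def opt_flow_row_sums)

text \<open>A self-consistency property: the reference matrix is built from the flow's own row sums,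
  and relative to it each entry is the minimiser \<open>q * exp c\<close> of
  \<open>kl_term_ge\<close>.\<close>

lemma opt_flow_index:
  assumes "t < T" "i < n" "j < n"
  shows "opt_flow t $$ (i, j)
    = (diag_of (source opt_flow t) * A t) $$ (i, j) * exp (gain opt_nu t i j)"
  using assms
  by (simp add: index_diag_of_mult[OF A_carrier source_carrier] opt_flow_carrier source_opt_flow
      opt_flow_def del: index_mult_mat)

lemma opt_flow_in_dom: "opt_flow \<in> flow_dom n T A mu"
proof -
  have "nonneg_mat (opt_flow t)" if "t < T" for t
    using that by (auto simp: nonneg_mat_def opt_flow_def
        intro!: mult_nonneg_nonneg marginal_nonneg A_nonneg)
  moreover have "supp_mat (opt_flow t) \<subseteq> supp_mat (A t)" if "t < T" for t
    using A_carrier[OF that] by (auto simp: supp_mat_def opt_flow_def)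
  moreover have "supp_mat (opt_flow 0) \<subseteq> supp_mat (diag_of mu * A 0)"
    using diag_of_mult_carrier[OF A_carrier mu_carrier, of 0] T_pos
    by (auto simp: supp_mat_def opt_flow_def index_diag_of_mult[OF A_carrier mu_carrier]
        simp del: index_mult_mat)
  ultimately show ?thesis by (simp add: flow_dom_def opt_flow_carrier)
qed

lemma lagrangian_opt_flow_opt_nu:
  "lagrangian prog opt_flow (case_constr lam opt_nu)
    = reduced_dual T A C rho mu lam + ones n \<bullet> mu"
proof -
  have "(\<Sum>t<T. kl_div (opt_flow t) (diag_of (source opt_flow t) * A t)
        - (\<Sum>i<n. \<Sum>j<n. gain opt_nu t i j * opt_flow t $$ (i, j)))
      = (\<Sum>t<T. if t = 0 then \<Sum>i<n. mu $ i * (1 - V 0 i) else 0)"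
  proof (rule sum.cong[OF refl])
    fix t assume "t \<in> {..<T}"
    then have t: "t < T" by simp
    show "kl_div (opt_flow t) (diag_of (source opt_flow t) * A t)
        - (\<Sum>i<n. \<Sum>j<n. gain opt_nu t i j * opt_flow t $$ (i, j))
      = (if t = 0 then \<Sum>i<n. mu $ i * (1 - V 0 i) else 0)"
      using kl_div_tilted_eq[OF opt_flow_carrier opt_flow_index[OF t]]
        tilted_mass[OF t source_carrier[of t opt_flow, OF t opt_flow_carrier]]
      by (simp add: source_def split: if_splits)
  qed
  then show ?thesis
    using lagrangian_eq[of opt_flow opt_nu] opt_flow_carrier T_pos
    by (simp add: reduced_dual_eq flow_multipliers_def opt_nu_def)
qed

text \<open>Row sums at time \<open>t\<close> equal column sums at time \<open>t - 1\<close>, so all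
  \<open>Flow\<close> residuals vanish and \<open>nu\<close> may be replaced by
  \<open>opt_nu\<close>; the \<open>Obs\<close> terms are unchanged because \<open>lam\<close> is
  fixed.\<close>

lemma lagrangian_opt_flow:
  assumes "nu \<in> flow_multipliers n T"
  shows "lagrangian prog opt_flow (case_constr lam nu)
    = reduced_dual T A C rho mu lam + ones n \<bullet> mu"
proof -
  have indep: "case_constr lam nu x \<bullet> flow_res n T C rho opt_flow x
      = case_constr lam opt_nu x \<bullet> flow_res n T C rho opt_flow x"
    if x: "x \<in> Obs ` {0..T} \<union> Flow ` {1..<T}" for x
  proof (cases x)
    case (Flow t)
    then have t: "1 \<le> t" "t < T" using x by auto
    have zero: "flow_res n T C rho opt_flow (Flow t) = 0\<^sub>v n"
      using t by (auto simp: opt_flow_row_sums opt_flow_col_sums simp del: marginal.simps)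
    have nu: "nu t \<in> carrier_vec n" "opt_nu t \<in> carrier_vec n"
      using assms t by (auto simp: flow_multipliers_def opt_nu_def)
    show ?thesis
      using scalar_prod_right_zero[OF nu(1)] scalar_prod_right_zero[OF nu(2)]
      by (simp only: Flow constr.case zero)
  qed simp
  have "lagrangian prog opt_flow (case_constr lam nu)
      = lagrangian prog opt_flow (case_constr lam opt_nu)"
    unfolding lagrangian_def flow_program_def eq_program.simps
    by (rule arg_cong[OF sum.cong[OF refl indep]])
  then show ?thesis by (simp add: lagrangian_opt_flow_opt_nu)
qed

section \<open>The dual function and its maximisation\<close>

lemma dual_fun_le:
  assumes "nu \<in> flow_multipliers n T"
  shows "dual_fun prog (case_constr lam nu)
    \<le> ereal (reduced_dual T A C rho mu lam + ones n \<bullet> mu)"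
  unfolding dual_fun_def
  \<comment> \<open>Only the domain field of the program is extracted, so the Lagrangian keeps the
    form of \<open>lagrangian_opt_flow\<close>.\<close>
  by (rule INF_lower2[of opt_flow])
    (simp_all add: opt_flow_in_dom flow_program_def[THEN arg_cong[where f = ep_dom]]
      lagrangian_opt_flow assms)

lemma opt_nu_flow_multipliers: "opt_nu \<in> flow_multipliers n T"
  by (simp add: flow_multipliers_def opt_nu_def)

lemma dual_fun_opt_nu:
  "dual_fun prog (case_constr lam opt_nu)
    = ereal (reduced_dual T A C rho mu lam + ones n \<bullet> mu)"
proof (rule antisym[OF dual_fun_le[OF opt_nu_flow_multipliers]])
  show "ereal (reduced_dual T A C rho mu lam + ones n \<bullet> mu)
      \<le> dual_fun prog (case_constr lam opt_nu)"
    unfolding dual_fun_def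
    by (intro INF_greatest)
      (simp add: lagrangian_ge flow_program_def[THEN arg_cong[where f = ep_dom]])
qed

end

text \<open>A function on \<open>constr\<close> is a pair of functions, one per constructor. The
  sets agree exactly because both sides leave components outside the index set arbitrary.\<close>

lemma multipliers_flow_program:
  "multipliers (flow_program n T A C rho mu)
    = {case_constr lam nu |lam nu. lam \<in> obs_multipliers (dim_row C) T \<and> nu \<in> flow_multipliers n T}"
  (is "?L = ?R")
proof (intro equalityI subsetI)
  fix y assume "y \<in> ?L"
  then have "y \<circ> Obs \<in> obs_multipliers (dim_row C) T" "y \<circ> Flow \<in> flow_multipliers n T"
    by (auto simp: multipliers_def flow_program_def obs_multipliers_def flow_multipliers_def ball_Un)
  moreover have "y = case_constr (y \<circ> Obs) (y \<circ> Flow)"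
    by (auto simp: fun_eq_iff split: constr.split)
  ultimately show "y \<in> ?R" by blast
next
  fix y assume "y \<in> ?R"
  then show "y \<in> ?L"
    by (auto simp: multipliers_def flow_program_def obs_multipliers_def flow_multipliers_def)
qed

theorem theorem3:
  fixes n T k :: nat
    and A :: "nat \<Rightarrow> real mat"
    and ps qs :: "nat list"
    and C Cbar :: "real mat"
    and rho :: "nat \<Rightarrow> real vec"
    and eta mu :: "real vec"
    and Q :: "(nat \<Rightarrow> real mat, constr) eq_program"
  assumes "n \<ge> 1" and "T \<ge> 1"
    and "\<forall>t<T. row_stochastic n (A t)"
    and "distinct ps" and "set ps \<subseteq> {0..<n}" and "length ps = k"
    and "distinct qs" and "set qs = {0..<n} - set ps"
    and "C = coord_sel n ps" and "Cbar = coord_sel n qs"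
    and "\<forall>t\<le>T. rho t \<in> carrier_vec k \<and> nonneg_vec (rho t)"
    and "eta \<in> carrier_vec (n - k)" and "nonneg_vec eta"
    and "mu = transpose_mat C *\<^sub>v rho 0 + transpose_mat Cbar *\<^sub>v eta"
    and "Q = flow_program n T A C rho mu"
  shows
    \<comment> \<open>for every \<open>lam\<close>, the dual function is maximised over the flow multipliers in closed form
      (\<open>case_constr lam nu\<close> has component \<open>lam t\<close> at \<open>Obs t\<close> and \<open>nu t\<close> at \<open>Flow t\<close>); hence the
      Lagrangian dual and the reduced problem have, up to the constant, the same value,
      and they have the same maximisers\<close>
    "(\<forall>lam\<in>obs_multipliers k T.
       (\<exists>nu\<in>flow_multipliers n T.
          dual_fun Q (case_constr lam nu) = ereal (reduced_dual T A C rho mu lam + ones n \<bullet> mu)) \<and>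
       (\<forall>nu\<in>flow_multipliers n T.
          dual_fun Q (case_constr lam nu) \<le> ereal (reduced_dual T A C rho mu lam + ones n \<bullet> mu))) \<and>
     dual_value Q =
       (SUP lam\<in>obs_multipliers k T. ereal (reduced_dual T A C rho mu lam + ones n \<bullet> mu)) \<and>
     (\<forall>lam\<in>obs_multipliers k T.
       (\<exists>nu\<in>flow_multipliers n T. dual_optimal Q (case_constr lam nu)) \<longleftrightarrow>
       (\<forall>lam'\<in>obs_multipliers k T.
          reduced_dual T A C rho mu lam' \<le> reduced_dual T A C rho mu lam))"
proof -
  have C: "C \<in> carrier_mat k n" using assms(6,9) by (simp add: coord_sel_def)
  \<comment> \<open>Fixes the number of rows of \<open>Cbar\<close>, so that its transpose acts on
    \<open>eta\<close> with matching dimensions.\<close>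
  have "card (set qs) = n - k"
    using assms(4-6,8) by (simp add: card_Diff_subset distinct_card)
  then have qs: "length qs = n - k" using assms(7) by (simp add: distinct_card)
  have mu: "mu \<in> carrier_vec n" using assms(9,10,14) by (auto simp: coord_sel_def intro!: carrier_vecI)
  have mu_nonneg: "0 \<le> mu $ i" if "i < n" for i
  proof -
    have "mu $ i = (transpose_mat C *\<^sub>v rho 0) $ i + (transpose_mat Cbar *\<^sub>v eta) $ i"
      using that assms(10,14) by (simp add: coord_sel_def)
    then show ?thesis
      using that assms(6,9-13) qs nonneg_transpose_coord_sel_mult[of "rho 0" ps i n]
        nonneg_transpose_coord_sel_mult[of eta qs i n]
      by simp
  qed
  define R where "R lam = reduced_dual T A C rho mu lam + ones n \<bullet> mu" for lam
  have df: "dual_flow n T k A C rho lam mu" if "lam \<in> obs_multipliers k T" for lam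
    using that assms(2,3,11) C mu mu_nonneg by unfold_locales (auto simp: obs_multipliers_def)
  have attained: "\<exists>nu\<in>flow_multipliers n T. dual_fun Q (case_constr lam nu) = ereal (R lam)"
    if "lam \<in> obs_multipliers k T" for lam
    using dual_flow.dual_fun_opt_nu[OF df[OF that]] dual_flow.opt_nu_flow_multipliers[OF df[OF that]]
    unfolding R_def assms(15) by blast
  have upper: "dual_fun Q (case_constr lam nu) \<le> ereal (R lam)"
    if "lam \<in> obs_multipliers k T" "nu \<in> flow_multipliers n T" for lam nu
    using dual_flow.dual_fun_le[OF df[OF that(1)] that(2)] by (simp add: R_def assms(15))
  have mult: "multipliers Q
      = {case_constr lam nu |lam nu. lam \<in> obs_multipliers k T \<and> nu \<in> flow_multipliers n T}"
    using C by (simp add: assms(15) multipliers_flow_program)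
  have val: "dual_value Q = (SUP lam\<in>obs_multipliers k T. ereal (R lam))"
    unfolding dual_value_def
  proof (rule antisym; rule SUP_least)
    fix y assume "y \<in> multipliers Q"
    then obtain lam nu where y: "y = case_constr lam nu" "lam \<in> obs_multipliers k T"
      "nu \<in> flow_multipliers n T"
      unfolding mult by blast
    then show "dual_fun Q y \<le> (SUP lam\<in>obs_multipliers k T. ereal (R lam))"
      by (auto intro!: SUP_upper2[of lam] upper)
  next
    fix lam assume lam: "lam \<in> obs_multipliers k T"
    then obtain nu where "nu \<in> flow_multipliers n T" "dual_fun Q (case_constr lam nu) = ereal (R lam)"
      using attained by blast
    then show "ereal (R lam) \<le> (SUP y\<in>multipliers Q. dual_fun Q y)"
      using lam by (intro SUP_upper2[of "case_constr lam nu"]) (auto simp: mult)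
  qed
  have opt: "(\<exists>nu\<in>flow_multipliers n T. dual_optimal Q (case_constr lam nu))
      \<longleftrightarrow> (\<forall>lam'\<in>obs_multipliers k T. R lam' \<le> R lam)" if lam: "lam \<in> obs_multipliers k T" for lam
  proof (intro iffI ballI)
    fix lam'
    assume "\<exists>nu\<in>flow_multipliers n T. dual_optimal Q (case_constr lam nu)"
      and lam': "lam' \<in> obs_multipliers k T"
    then obtain nu where nu: "nu \<in> flow_multipliers n T" "dual_optimal Q (case_constr lam nu)" by blast
    obtain nu' where nu': "nu' \<in> flow_multipliers n T"
      "dual_fun Q (case_constr lam' nu') = ereal (R lam')"
      using attained[OF lam'] by blast
    have "case_constr lam' nu' \<in> multipliers Q" using lam' nu' by (auto simp: mult)
    \<comment> \<open>Optimality is compared with a pair that attains \<open>R lam'\<close>; at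
      \<open>lam\<close> itself the uniform upper bound suffices.\<close>
    then have "ereal (R lam') \<le> dual_fun Q (case_constr lam nu)"
      using nu nu' by (auto simp: dual_optimal_def)
    also have "\<dots> \<le> ereal (R lam)" using upper[OF lam nu(1)] .
    finally show "R lam' \<le> R lam" by simp
  next
    assume best: "\<forall>lam'\<in>obs_multipliers k T. R lam' \<le> R lam"
    obtain nu where nu: "nu \<in> flow_multipliers n T" "dual_fun Q (case_constr lam nu) = ereal (R lam)"
      using attained[OF lam] by blast
    \<comment> \<open>Conversely, a \<open>nu\<close> attaining \<open>R lam\<close> is optimal,
      since every competitor is bounded by some \<open>R lam'\<close> and hence by
      \<open>R lam\<close>.\<close>
    have "dual_fun Q y \<le> ereal (R lam)" if "y \<in> multipliers Q" for y
    proof -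
      obtain lam' nu' where y: "y = case_constr lam' nu'" "lam' \<in> obs_multipliers k T"
        "nu' \<in> flow_multipliers n T"
        using \<open>y \<in> multipliers Q\<close> unfolding mult by blast
      then have "dual_fun Q y \<le> ereal (R lam')" using upper by simp
      also have "\<dots> \<le> ereal (R lam)" using best y by simp
      finally show ?thesis .
    qed
    then show "\<exists>nu\<in>flow_multipliers n T. dual_optimal Q (case_constr lam nu)"
      using lam nu by (intro bexI[of _ nu]) (auto simp: dual_optimal_def mult)
  qed
  \<comment> \<open>The constant mass of \<open>mu\<close> cancels when values of \<open>R\<close>
    are compared.\<close>
  show ?thesis
    using attained upper val opt by (simp add: R_def)
qed

end
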